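(* For every odd integer $a \geq 7$, \[ R_3\bigl(ax+ay=(a+1)z\bigr) \geq a^3(a+1). \]
   Context: For a linear equation $\mathcal{E}$ in the unknowns $x,y,z$ and a positive integer $k$, the $k$-colour Rado number $R_k(\mathcal{E})$ is the smallest positive integer $n$, if it exists, such that every colouring of $\{1,2,\dots,n\}$ with $k$ colours contains a monochromatic solution to $\mathcal{E}$, i.e. a solution $(x,y,z)$ with $x,y,z\in\{1,\dots,n\}$ (not necessarily distinct) all of the same colour; $R_k(\mathcal{E})=\infty$ if no such $n$ exists. In the paper's notation the equation $ax+ay=(a+1)z$ is written $\mathcal{E}(3,0;a,a,a+1)$. *)

theory Defs
  imports Main "HOL-Library.Extended_Nat"
begin

text \<open>
  An equation in the unknowns x, y, z is represented by its solution predicate on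
  the natural numbers. The k colours are the numbers below k, and a colouring of
  {1..n} is a function whose values outside {1..n} are irrelevant.
\<close>

definition mono_solution ::
    "(nat \<Rightarrow> nat \<Rightarrow> nat \<Rightarrow> bool) \<Rightarrow> nat \<Rightarrow> (nat \<Rightarrow> nat) \<Rightarrow> bool" where
  "mono_solution E n \<chi> \<longleftrightarrow>
     (\<exists>x\<in>{1..n}. \<exists>y\<in>{1..n}. \<exists>z\<in>{1..n}. E x y z \<and> \<chi> x = \<chi> y \<and> \<chi> y = \<chi> z)"

definition rado_property ::
    "nat \<Rightarrow> (nat \<Rightarrow> nat \<Rightarrow> nat \<Rightarrow> bool) \<Rightarrow> nat \<Rightarrow> bool" where
  "rado_property k E n \<longleftrightarrow>
     (\<forall>\<chi> :: nat \<Rightarrow> nat. \<chi> ` {1..n} \<subseteq> {..<k} \<longrightarrow> mono_solution E n \<chi>)"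

definition rado_number :: "nat \<Rightarrow> (nat \<Rightarrow> nat \<Rightarrow> nat \<Rightarrow> bool) \<Rightarrow> enat" where
  "rado_number k E =
     (if \<exists>n\<ge>1. rado_property k E n
      then enat (LEAST n. n \<ge> 1 \<and> rado_property k E n) else \<infinity>)"

end

theory Submission
  imports Defs
begin

text \<open>
  Since \<open>a\<close> and \<open>a + 1\<close> are coprime, the solutions of \<open>a x + a y = (a + 1) z\<close> are the triples with
  \<open>z = a m\<close> and \<open>x + y = (a + 1) m\<close>.

  A solution-free 2-colouring below \<open>M\<close> lifts to a solution-free 3-colouring below \<open>a\<^sup>2 M\<close>: multiples
  of \<open>a\<^sup>2\<close> inherit the two colours, the other multiples of \<open>a\<close> get the third colour, and the
  non-multiples of \<open>a\<close> get one of the first two colours according to whether their residue modulo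
  \<open>a\<close> lies in the lower or in the upper half. In a monochromatic solution \<open>a\<^sup>2\<close> divides \<open>z\<close>, so
  \<open>a\<close> divides \<open>x + y\<close>; opposite residues have different colours, hence \<open>a\<^sup>2\<close> divides all three
  unknowns and can be cancelled.

  Below \<open>M = a (a + 1)\<close> the same idea modulo \<open>a + 1 = 2 b\<close> leaves only solutions in which \<open>b\<close>
  divides both \<open>x\<close> and \<open>y\<close>. Colouring the multiples of \<open>b\<close> by whether they are at most \<open>b\<^sup>2\<close> removes
  these: it forces \<open>m \<le> b\<close> or \<open>m > b\<close>, while the colour of \<open>z = a m\<close> is determined by the residue
  \<open>- m\<close> modulo \<open>2 b\<close>.
\<close>

lemma rado_number_geI:
  assumes "\<chi> ` {1..<N} \<subseteq> {..<k}"
    and "\<And>x y z. \<lbrakk>x \<in> {1..<N}; y \<in> {1..<N}; z \<in> {1..<N}; E x y z; \<chi> x = \<chi> y; \<chi> y = \<chi> z\<rbrakk> \<Longrightarrow> False"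
  shows "enat N \<le> rado_number k E"
proof -
  have ge: "N \<le> n" if "rado_property k E n" for n
  proof (rule ccontr)
    assume "\<not> N \<le> n"
    then have sub: "{1..n} \<subseteq> {1..<N}" by auto
    with assms(1) have "\<chi> ` {1..n} \<subseteq> {..<k}" by blast
    with that have "mono_solution E n \<chi>" by (simp add: rado_property_def)
    with sub assms(2) show False unfolding mono_solution_def by blast
  qed
  show ?thesis
  proof (cases "\<exists>n\<ge>1. rado_property k E n")
    case True
    then have "rado_property k E (LEAST n. n \<ge> 1 \<and> rado_property k E n)"
      by (rule LeastI2_ex) simp
    with True ge show ?thesis by (simp add: rado_number_def)
  next
    case False
    then show ?thesis unfolding rado_number_def by (simp only: if_False enat_ord_code)
  qed
qed

lemma eq_Suc_mult_obtain:
  fixes a x y z :: nat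
  assumes "a * x + a * y = (a + 1) * z" and "a > 0"
  obtains m where "z = a * m" and "x + y = (a + 1) * m"
proof -
  have "a dvd (a + 1) * z"
    unfolding assms(1)[symmetric] by simp
  moreover have "coprime a (a + 1)" by simp
  ultimately have "a dvd z"
    using coprime_dvd_mult_right_iff by blast
  then obtain m where m: "z = a * m" ..
  with assms have "a * (x + y) = a * ((a + 1) * m)"
    by (simp add: algebra_simps)
  with assms(2) have "x + y = (a + 1) * m"
    by (metis mult_left_cancel neq0_conv)
  with m that show thesis by blast
qed

text \<open>Both residues are below \<open>d\<close> and that of \<open>x\<close> is positive, so
  their sum, a multiple of \<open>d\<close>, is \<open>d\<close> itself; with the tie at
  \<open>d / 2\<close> excluded, exactly one lies in the lower half.\<close>

lemma opposite_residues_halves: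
  fixes d x y :: nat
  assumes "d dvd x + y" and "\<not> d dvd x" and "2 * (x mod d) \<noteq> d"
  shows "2 * (x mod d) < d \<longleftrightarrow> \<not> 2 * (y mod d) < d"
proof -
  have "0 < d" using assms by (cases "d = 0") auto
  then have lt: "x mod d < d" "y mod d < d" by simp_all
  have pos: "0 < x mod d" using assms(2) by (simp add: mod_greater_zero_iff_not_dvd)
  have "d dvd x mod d + y mod d"
    using assms(1) by (simp add: dvd_eq_mod_eq_0 mod_add_eq)
  then obtain k where k: "x mod d + y mod d = d * k" ..
  have "d * k < d * 2" "0 < d * k" using lt pos k by linarith+
  then have "k = 1" by auto
  with k assms(3) show ?thesis by simp linarith
qed

lemma three_colouring_lift:
  fixes a M :: nat and f :: "nat \<Rightarrow> bool"
  assumes "odd a" and f: "\<And>x y z. \<lbrakk>x \<in> {1..<M}; y \<in> {1..<M}; z \<in> {1..<M};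
      a * x + a * y = (a + 1) * z; f x = f y; f y = f z\<rbrakk> \<Longrightarrow> False"
  shows "enat (a\<^sup>2 * M) \<le> rado_number 3 (\<lambda>x y z. a * x + a * y = (a + 1) * z)"
proof -
  \<comment> \<open>On multiples of \<open>a\<close> that \<open>a\<^sup>2\<close> does not divide,
    \<open>h\<close> is only a dummy: \<open>\<chi>\<close> is 2 there.\<close>
  define h where "h n = (if a dvd n then f (n div a\<^sup>2) else 2 * (n mod a) < a)" for n
  define \<chi> :: "nat \<Rightarrow> nat" where
    "\<chi> n = (if a dvd n \<and> \<not> a\<^sup>2 dvd n then 2 else if h n then 1 else 0)" for n
  have a: "a > 0" using \<open>odd a\<close> by (rule odd_pos)
  have \<chi>2: "\<chi> n = 2 \<longleftrightarrow> a dvd n \<and> \<not> a\<^sup>2 dvd n" for n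
    by (simp add: \<chi>_def)
  have \<chi>h: "h m = h n" if "\<chi> m = \<chi> n" "\<chi> n \<noteq> 2" for m n
    using that by (auto simp: \<chi>_def split: if_splits)
  show ?thesis
  proof (rule rado_number_geI)
    show "\<chi> ` {1..<a\<^sup>2 * M} \<subseteq> {..<3}" by (auto simp: \<chi>_def)
  next
    fix x y z
    assume range: "x \<in> {1..<a\<^sup>2 * M}" "y \<in> {1..<a\<^sup>2 * M}" "z \<in> {1..<a\<^sup>2 * M}"
      and eq: "a * x + a * y = (a + 1) * z" and mono: "\<chi> x = \<chi> y" "\<chi> y = \<chi> z"
    obtain m where z: "z = a * m" and xy: "x + y = (a + 1) * m"
      using eq_Suc_mult_obtain[OF eq a] .
    have ne2: "\<chi> z \<noteq> 2"
    proof
      assume "\<chi> z = 2"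
      with mono have "a dvd x" "a dvd y" "\<not> a\<^sup>2 dvd z" by (metis \<chi>2)+
      then have "a dvd (a + 1) * m" unfolding xy[symmetric] by simp
      then have "a dvd m" using coprime_dvd_mult_right_iff[of a "a + 1" m] by simp
      with \<open>\<not> a\<^sup>2 dvd z\<close> show False by (simp add: z power2_eq_square)
    qed
    then have "a\<^sup>2 dvd z" using \<chi>2 z by auto
    then have "a dvd m" using a by (simp add: z power2_eq_square)
    then have dvd_sum: "a dvd x + y" by (simp add: xy)
    have heq: "h x = h y" "h y = h z" using \<chi>h mono ne2 by metis+
    have dx: "a dvd x"
    proof (rule ccontr)
      assume nx: "\<not> a dvd x"
      with dvd_sum have "\<not> a dvd y" by (metis dvd_add_left_iff)
      moreover have "2 * (x mod a) \<noteq> a" using \<open>odd a\<close> by (metis dvd_triv_left)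
      ultimately show False
        using opposite_residues_halves[OF dvd_sum nx] heq(1) nx by (simp add: h_def)
    qed
    with dvd_sum have dy: "a dvd y" by (simp add: dvd_add_right_iff)
    have "a\<^sup>2 dvd x" "a\<^sup>2 dvd y" using dx dy mono ne2 \<chi>2 by metis+
    with \<open>a\<^sup>2 dvd z\<close> obtain X Y Z where XYZ: "x = a\<^sup>2 * X" "y = a\<^sup>2 * Y" "z = a\<^sup>2 * Z"
      by (auto elim!: dvdE)
    have "a\<^sup>2 * (a * X + a * Y) = a\<^sup>2 * ((a + 1) * Z)"
      using eq by (simp add: XYZ algebra_simps)
    then have "a * X + a * Y = (a + 1) * Z" using a by simp
    moreover have "f X = f Y" "f Y = f Z"
      using heq a by (simp_all add: h_def XYZ power2_eq_square)
    moreover have "X \<in> {1..<M}" "Y \<in> {1..<M}" "Z \<in> {1..<M}"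
      using range a by (auto simp: XYZ)
    ultimately show False using f by blast
  qed
qed

lemma two_colouring:
  fixes b :: nat
  assumes "b > 1"
  defines "a \<equiv> 2 * b - 1"
  defines "f \<equiv> \<lambda>x. if b dvd x then x \<le> b\<^sup>2 else 2 * (x mod (2 * b)) < 2 * b"
  assumes z_range: "z \<in> {1..<a * (a + 1)}"
    and eq: "a * x + a * y = (a + 1) * z" and mono: "f x = f y" "f y = f z"
  shows False
proof -
  have ab: "a + 1 = 2 * b" "b < a" using assms(1) by (auto simp: a_def)
  then have "a > 0" by simp
  from eq_Suc_mult_obtain[OF eq this]
  obtain m where z: "z = a * m" and xy: "x + y = 2 * b * m" by (metis ab(1))
  have m: "0 < m" using z_range by (cases m) (auto simp: z)
  \<comment> \<open>The bound on \<open>z\<close> makes \<open>m\<close> its own residue modulo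
    \<open>2 * b\<close>.\<close>
  have "a * m < a * (a + 1)" using z_range by (simp only: z atLeastLessThan_iff)
  with ab(1) have m2: "m < 2 * b" using mult_less_cancel1 by metis
  have res: "f z \<longleftrightarrow> b < m" if "m \<noteq> b"
  proof -
    have "z + m = 2 * b * m" by (simp add: z ab(1)[symmetric])
    then have sum: "2 * b dvd m + z" by (simp add: add.commute)
    have "m mod (2 * b) = m" using m2 by simp
    then have "2 * (m mod (2 * b)) < 2 * b \<longleftrightarrow> \<not> 2 * (z mod (2 * b)) < 2 * b"
      using opposite_residues_halves[OF sum] m m2 that by (simp add: nat_dvd_not_less)
    moreover have "\<not> b dvd z"
    proof
      assume "b dvd z"
      then have "b dvd m" using sum by (metis dvd_add_left_iff dvd_mult_right mult.commute)
      then obtain k where "m = b * k" ..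
      \<comment> \<open>The only multiple of \<open>b\<close> strictly between 0 and
        \<open>2 * b\<close> is \<open>b\<close>.\<close>
      with m m2 that show False by (cases k; cases "k - 1") auto
    qed
    ultimately show ?thesis using \<open>m mod (2 * b) = m\<close> that by (auto simp: f_def)
  qed
  have bx: "b dvd x"
  proof (rule ccontr)
    assume nx: "\<not> b dvd x"
    have "b dvd x + y" by (simp add: xy)
    with nx have ny: "\<not> b dvd y" by (metis dvd_add_left_iff)
    have "\<not> 2 * b dvd x" using nx by (metis dvd_mult_right)
    \<comment> \<open>A tie would mean \<open>x mod (2 * b) = b\<close>, hence
      \<open>b dvd x\<close>.\<close>
    moreover have "2 * (x mod (2 * b)) \<noteq> 2 * b"
      using nx by (metis dvd_mod_imp_dvd dvd_refl dvd_triv_right mult_left_cancel zero_neq_numeral)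
    ultimately have "2 * (x mod (2 * b)) < 2 * b \<longleftrightarrow> \<not> 2 * (y mod (2 * b)) < 2 * b"
      using xy by (intro opposite_residues_halves) simp_all
    with nx ny mono(1) show False by (simp add: f_def)
  qed
  moreover have "b dvd x + y" by (simp add: xy)
  ultimately have dy: "b dvd y" using dvd_add_right_iff by blast
  show False
  proof (cases "f x")
    case True
    then have "x \<le> b\<^sup>2" "y \<le> b\<^sup>2" using mono bx dy by (auto simp: f_def)
    then have "b * m \<le> b * b" using xy unfolding power2_eq_square by linarith
    then have "m \<le> b" using assms(1) by simp
    moreover have "f z" using True mono by simp
    ultimately have "m = b" using res by fastforce
    \<comment> \<open>Now \<open>z = a * b\<close> is a multiple of \<open>b\<close> exceeding
      \<open>b\<^sup>2\<close>, because \<open>a > b\<close>.\<close>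
    then have "\<not> f z" using ab(2) assms(1) by (simp add: f_def z power2_eq_square)
    with \<open>f z\<close> show False by contradiction
  next
    case False
    then have "x > b\<^sup>2" "y > b\<^sup>2" using mono bx dy by (auto simp: f_def)
    then have "b * b < b * m" using xy unfolding power2_eq_square by linarith
    then have "b < m" by simp
    with res False mono show False by auto
  qed
qed

theorem theorem4:
  fixes a :: nat
  assumes "odd a" and "a \<ge> 7"
  shows "rado_number 3 (\<lambda>x y z. a * x + a * y = (a + 1) * z) \<ge> enat (a ^ 3 * (a + 1))"
proof -
  from \<open>odd a\<close> have "even (a + 1)" by simp
  then obtain b where "a + 1 = 2 * b" ..
  with \<open>a \<ge> 7\<close> have b: "b > 1" "a = 2 * b - 1" by auto
  have "enat (a\<^sup>2 * (a * (a + 1))) \<le> rado_number 3 (\<lambda>x y z. a * x + a * y = (a + 1) * z)"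
    using \<open>odd a\<close> two_colouring[OF b(1), folded b(2)] by (rule three_colouring_lift)
  moreover have "a\<^sup>2 * (a * (a + 1)) = a ^ 3 * (a + 1)"
    by (simp only: power2_eq_square power3_eq_cube mult.assoc)
  ultimately show ?thesis by simp
qed

end
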